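(* Let $(A,\mu,\alpha)$ be a multiplicative Hom-Jordan algebra over $\mathbf{k}$, and write $xy=\mu(x,y)$. Define the triple product $$\{xyz\} = \alpha(x)(yz) + (xy)\alpha(z) - \alpha(y)(xz)$$ for $x,y,z\in A$. Then $A_T = (A,\{,,\},\alpha^2)$ is a multiplicative Hom-Jordan triple system (with both twisting maps equal to $\alpha^2$).
   Context: $\mathbf{k}$ is a fixed field of characteristic $0$; $\alpha^k$ denotes $k$-fold composition. A multiplicative Hom-algebra $(A,\mu,\alpha)$ is a $\mathbf{k}$-module $A$ with a bilinear map $\mu\colon A\otimes A\to A$ (no associativity assumed) and a linear map $\alpha\colon A\to A$ such that $\alpha(\mu(x,y))=\mu(\alpha(x),\alpha(y))$. Its Hom-associator is $as_A(x,y,z) = (xy)\alpha(z) - \alpha(x)(yz)$. A Hom-Jordan algebra is a Hom-algebra $(A,\mu,\alpha)$ such that $\mu$ is commutative ($xy=yx$) and $as_A(x^2,\alpha(y),\alpha(x))=0$ for all $x,y\in A$, where $x^2=\mu(x,x)$. A Hom-Jordan triple system $(J,\{,,\},(\alpha_1,\alpha_2))$ is a $\mathbf{k}$-module $J$ with a trilinear map $\{,,\}\colon J^{\otimes 3}\to J$ and linear maps $\alpha_1,\alpha_2\colon J\to J$ (the twisting maps) such that, for all $u,v,w,x,y,z\in J$, $\{xyz\}=\{zyx\}$ and $$\{\alpha_1(x)\,\alpha_2(y)\,\{uvw\}\} - \{\alpha_1(u)\,\alpha_2(v)\,\{xyw\}\} = \{\{xyu\}\,\alpha_1(v)\,\alpha_2(w)\}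 - \{\alpha_1(u)\,\{yxv\}\,\alpha_2(w)\}.$$ When $\alpha_1=\alpha_2=\gamma$ it is written $(J,\{,,\},\gamma)$; it is multiplicative if $\alpha_1=\alpha_2=\gamma$ and $\gamma(\{xyz\})=\{\gamma(x)\gamma(y)\gamma(z)\}$ for all $x,y,z$. *)

theory Defs
  imports Complex_Main
begin

text \<open>
  The ground field is the type \<open>'k\<close>; a \<open>'k\<close>-module is the whole type \<open>'a\<close> with the scalar
  multiplication \<open>scale\<close>. Maps out of tensor powers are given as multilinear curried functions.
\<close>

definition bilinear_map :: "('k::field \<Rightarrow> 'a::ab_group_add \<Rightarrow> 'a) \<Rightarrow> ('a \<Rightarrow> 'a \<Rightarrow> 'a) \<Rightarrow> bool" where
  "bilinear_map scale f \<longleftrightarrow>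
    (\<forall>y. Vector_Spaces.linear scale scale (\<lambda>x. f x y)) \<and>
    (\<forall>x. Vector_Spaces.linear scale scale (\<lambda>y. f x y))"

definition trilinear_map :: "('k::field \<Rightarrow> 'a::ab_group_add \<Rightarrow> 'a) \<Rightarrow> ('a \<Rightarrow> 'a \<Rightarrow> 'a \<Rightarrow> 'a) \<Rightarrow> bool" where
  "trilinear_map scale f \<longleftrightarrow>
    (\<forall>y z. Vector_Spaces.linear scale scale (\<lambda>x. f x y z)) \<and>
    (\<forall>x z. Vector_Spaces.linear scale scale (\<lambda>y. f x y z)) \<and>
    (\<forall>x y. Vector_Spaces.linear scale scale (\<lambda>z. f x y z))"

locale multiplicative_hom_algebra = vector_space scale
  for scale :: "'k::field_char_0 \<Rightarrow> 'a::ab_group_add \<Rightarrow> 'a" +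
  fixes \<mu> :: "'a \<Rightarrow> 'a \<Rightarrow> 'a"
    and \<alpha> :: "'a \<Rightarrow> 'a"
  assumes bilinear_mult: "bilinear_map scale \<mu>"
    and linear_twist: "Vector_Spaces.linear scale scale \<alpha>"
    and twist_mult: "\<alpha> (\<mu> x y) = \<mu> (\<alpha> x) (\<alpha> y)"

definition hom_associator ::
    "('a::ab_group_add \<Rightarrow> 'a \<Rightarrow> 'a) \<Rightarrow> ('a \<Rightarrow> 'a) \<Rightarrow> 'a \<Rightarrow> 'a \<Rightarrow> 'a \<Rightarrow> 'a" where
  "hom_associator \<mu> \<alpha> x y z = \<mu> (\<mu> x y) (\<alpha> z) - \<mu> (\<alpha> x) (\<mu> y z)"

locale multiplicative_hom_jordan_algebra = multiplicative_hom_algebra scale \<mu> \<alpha>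
  for scale :: "'k::field_char_0 \<Rightarrow> 'a::ab_group_add \<Rightarrow> 'a"
    and \<mu> :: "'a \<Rightarrow> 'a \<Rightarrow> 'a"
    and \<alpha> :: "'a \<Rightarrow> 'a" +
  assumes mult_commute: "\<mu> x y = \<mu> y x"
    and hom_jordan_identity: "hom_associator \<mu> \<alpha> (\<mu> x x) (\<alpha> y) (\<alpha> x) = 0"

locale hom_jordan_triple_system = vector_space scale
  for scale :: "'k::field_char_0 \<Rightarrow> 'a::ab_group_add \<Rightarrow> 'a" +
  fixes T :: "'a \<Rightarrow> 'a \<Rightarrow> 'a \<Rightarrow> 'a"
    and \<alpha>\<^sub>1 :: "'a \<Rightarrow> 'a"
    and \<alpha>\<^sub>2 :: "'a \<Rightarrow> 'a"
  assumes trilinear_triple: "trilinear_map scale T"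
    and linear_twist1: "Vector_Spaces.linear scale scale \<alpha>\<^sub>1"
    and linear_twist2: "Vector_Spaces.linear scale scale \<alpha>\<^sub>2"
    and outer_symmetry: "T x y z = T z y x"
    and hom_jordan_triple_identity:
      "T (\<alpha>\<^sub>1 x) (\<alpha>\<^sub>2 y) (T u v w) - T (\<alpha>\<^sub>1 u) (\<alpha>\<^sub>2 v) (T x y w)
        = T (T x y u) (\<alpha>\<^sub>1 v) (\<alpha>\<^sub>2 w) - T (\<alpha>\<^sub>1 u) (T y x v) (\<alpha>\<^sub>2 w)"

locale multiplicative_hom_jordan_triple_system = hom_jordan_triple_system scale T \<gamma> \<gamma>
  for scale :: "'k::field_char_0 \<Rightarrow> 'a::ab_group_add \<Rightarrow> 'a"
    and T :: "'a \<Rightarrow> 'a \<Rightarrow> 'a \<Rightarrow> 'a"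
    and \<gamma> :: "'a \<Rightarrow> 'a" +
  assumes twist_triple: "\<gamma> (T x y z) = T (\<gamma> x) (\<gamma> y) (\<gamma> z)"

definition jordan_triple_product ::
    "('a::ab_group_add \<Rightarrow> 'a \<Rightarrow> 'a) \<Rightarrow> ('a \<Rightarrow> 'a) \<Rightarrow> 'a \<Rightarrow> 'a \<Rightarrow> 'a \<Rightarrow> 'a" where
  "jordan_triple_product \<mu> \<alpha> x y z =
    \<mu> (\<alpha> x) (\<mu> y z) + \<mu> (\<mu> x y) (\<alpha> z) - \<mu> (\<alpha> y) (\<mu> x z)"

end

theory Submission
  imports Defs
begin

text \<open>
  In a Jordan algebra, with \<open>L\<^sub>x\<close> denoting multiplication by \<open>x\<close>, the operator
  \<open>{x y _}\<close> is \<open>L\<^sub>x\<^sub>y + [L\<^sub>x, L\<^sub>y]\<close>, and the triple identity describes the commutator of two such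
  operators. Two facts are enough to prove it: the linearised Jordan identity
  \<open>[L\<^sub>x\<^sub>y, L\<^sub>z] + [L\<^sub>y\<^sub>z, L\<^sub>x] + [L\<^sub>z\<^sub>x, L\<^sub>y] = 0\<close>, and its consequence that \<open>[L\<^sub>x, L\<^sub>y]\<close> is a derivation
  of the product, hence of the triple product. The derivation part of \<open>{x y _}\<close> contributes to
  the triple identity by the Leibniz rule alone; the part \<open>L\<^sub>a\<close> with \<open>a = xy\<close> contributes by
  combining the derivation property of \<open>[L\<^sub>u, L\<^sub>v]\<close> with the linearised Jordan identity for
  \<open>a\<close>, \<open>u\<close>, \<open>v\<close>. As \<open>{y x _}\<close> is \<open>L\<^sub>x\<^sub>y - [L\<^sub>x, L\<^sub>y]\<close>, the two contributions add up to the triple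
  identity.

  The argument survives the twist because every term is balanced: in each product of a given
  degree, the power of \<open>\<alpha>\<close> applied to a factor plus the number of multiplications that the factor
  is nested in is the same for all factors and all terms. Substituting a product \<open>uv\<close> for one
  variable of a balanced identity and \<open>\<alpha> x\<close> for each other variable \<open>x\<close> gives a balanced identity
  again, so the classical identities can be combined without ever inverting \<open>\<alpha>\<close>.
\<close>

context multiplicative_hom_algebra
begin

lemma mult_left_linear: "Vector_Spaces.linear scale scale (\<lambda>x. \<mu> x y)"
  using bilinear_mult by (simp add: bilinear_map_def)

lemma mult_right_linear: "Vector_Spaces.linear scale scale (\<mu> x)"
  using bilinear_mult by (simp add: bilinear_map_def)

interpretation twist: Vector_Spaces.linear scale scale \<alpha>
  by (rule linear_twist)

interpretation left: Vector_Spaces.linear scale scale "\<lambda>x. \<mu> x y" for y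
  by (rule mult_left_linear)

interpretation right: Vector_Spaces.linear scale scale "\<mu> x" for x
  by (rule mult_right_linear)

lemmas add_simps =
  twist.add twist.diff left.add left.diff right.add right.diff

lemmas scale_simps =
  twist.scale left.scale right.scale

lemma trilinear_jordan_triple_product: "trilinear_map scale (jordan_triple_product \<mu> \<alpha>)"
  unfolding trilinear_map_def jordan_triple_product_def Vector_Spaces.linear_iff
  using vector_space_axioms
  by (simp add: add_simps scale_simps scale_right_distrib scale_right_diff_distrib)

lemma twist_jordan_triple_product:
  "\<alpha> (jordan_triple_product \<mu> \<alpha> x y z) = jordan_triple_product \<mu> \<alpha> (\<alpha> x) (\<alpha> y) (\<alpha> z)"
  by (simp add: jordan_triple_product_def add_simps twist_mult)

text \<open>The balanced form of \<open>[L\<^sub>x, L\<^sub>y] z\<close>.\<close>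

definition inner_derivation :: "'a \<Rightarrow> 'a \<Rightarrow> 'a \<Rightarrow> 'a" where
  "inner_derivation x y z = \<mu> (\<alpha> x) (\<mu> y z) - \<mu> (\<alpha> y) (\<mu> x z)"

lemma inner_derivation_swap: "inner_derivation x y z = - inner_derivation y x z"
  by (simp add: inner_derivation_def)

lemma inner_derivation_add:
  "inner_derivation x y (z + w) = inner_derivation x y z + inner_derivation x y w"
  by (simp add: inner_derivation_def add_simps)

lemma inner_derivation_diff:
  "inner_derivation x y (z - w) = inner_derivation x y z - inner_derivation x y w"
  by (simp add: inner_derivation_def add_simps)

lemma twist_inner_derivation:
  "\<alpha> (inner_derivation x y z) = inner_derivation (\<alpha> x) (\<alpha> y) (\<alpha> z)"
  by (simp add: inner_derivation_def add_simps twist_mult)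

lemma jordan_triple_product_eq:
  "jordan_triple_product \<mu> \<alpha> x y z = \<mu> (\<mu> x y) (\<alpha> z) + inner_derivation x y z"
  by (simp add: jordan_triple_product_def inner_derivation_def)

lemma jordan_triple_product_add_left:
  "jordan_triple_product \<mu> \<alpha> (x + x') y z =
    jordan_triple_product \<mu> \<alpha> x y z + jordan_triple_product \<mu> \<alpha> x' y z"
  by (simp add: jordan_triple_product_def add_simps)

lemma jordan_triple_product_diff_middle:
  "jordan_triple_product \<mu> \<alpha> x (y - y') z =
    jordan_triple_product \<mu> \<alpha> x y z - jordan_triple_product \<mu> \<alpha> x y' z"
  by (simp add: jordan_triple_product_def add_simps)

lemma jordan_triple_product_add_right:
  "jordan_triple_product \<mu> \<alpha> x y (z + z') =
    jordan_triple_product \<mu> \<alpha> x y z + jordan_triple_product \<mu> \<alpha> x y z'"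
  by (simp add: jordan_triple_product_def add_simps)

end

context multiplicative_hom_jordan_algebra
begin

lemma jordan_triple_product_commute:
  "jordan_triple_product \<mu> \<alpha> x y z = jordan_triple_product \<mu> \<alpha> z y x"
  by (simp add: jordan_triple_product_def mult_commute)

text \<open>
  The Jordan identity is cubic in \<open>x\<close>. Its full polarisation is a sum over all orderings of three
  arguments; by commutativity of the product each cyclic class occurs twice, and the factor 2 is
  invertible in characteristic 0.
\<close>

lemma linearised_jordan_identity:
  "inner_derivation (\<mu> x y) (\<alpha> z) (\<alpha> w) + inner_derivation (\<mu> y z) (\<alpha> x) (\<alpha> w)
    + inner_derivation (\<mu> z x) (\<alpha> y) (\<alpha> w) = 0"
proof -
  define F where "F a = hom_associator \<mu> \<alpha> (\<mu> a a) (\<alpha> w) (\<alpha> a)" for a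
  define s where "s = inner_derivation (\<mu> x y) (\<alpha> z) (\<alpha> w) + inner_derivation (\<mu> y z) (\<alpha> x) (\<alpha> w)
    + inner_derivation (\<mu> z x) (\<alpha> y) (\<alpha> w)"
  \<comment> \<open>Inclusion--exclusion extracts from the cubic map \<open>F\<close> its part that is linear in each of
    \<open>x\<close>, \<open>y\<close>, \<open>z\<close>, up to sign.\<close>
  have "F (x + y) + F (y + z) + F (x + z) - F (x + y + z) - F x - F y - F z = s + s"
    unfolding F_def s_def hom_associator_def inner_derivation_def
    by (simp add: add_simps mult_commute algebra_simps)
  moreover have "F a = 0" for a
    unfolding F_def by (rule hom_jordan_identity)
  ultimately have "s + s = 0"
    by simp
  moreover have "scale 2 s = s + s"
    using scale_left_distrib[of 1 1 s] by simp
  ultimately have "s = 0"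
    by simp
  then show ?thesis
    by (simp add: s_def)
qed

text \<open>
  Half of the terms of the linearised Jordan identity form the sum of the three products of two
  pairs from \<open>x, y, z, w\<close>, which is symmetric in all four variables. The other half singles out one
  variable. Subtracting the identity that singles out \<open>y\<close> from the one that singles out \<open>x\<close>
  removes the symmetric terms; what remains is the Leibniz rule.
\<close>

lemma inner_derivation_mult:
  "inner_derivation (\<alpha> x) (\<alpha> y) (\<mu> z w) =
    \<mu> (inner_derivation x y z) (\<alpha> (\<alpha> w)) + \<mu> (\<alpha> (\<alpha> z)) (inner_derivation x y w)"
  using linearised_jordan_identity[of w y z x] linearised_jordan_identity[of x w z y]
  unfolding inner_derivation_def
  by (simp add: add_simps twist_mult mult_commute algebra_simps)

lemma inner_derivation_jordan_triple_product:
  "inner_derivation (\<alpha> (\<alpha> x)) (\<alpha> (\<alpha> y)) (jordan_triple_product \<mu> \<alpha> u v w) =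
    jordan_triple_product \<mu> \<alpha> (inner_derivation x y u) (\<alpha> (\<alpha> v)) (\<alpha> (\<alpha> w))
    + jordan_triple_product \<mu> \<alpha> (\<alpha> (\<alpha> u)) (inner_derivation x y v) (\<alpha> (\<alpha> w))
    + jordan_triple_product \<mu> \<alpha> (\<alpha> (\<alpha> u)) (\<alpha> (\<alpha> v)) (inner_derivation x y w)"
  unfolding jordan_triple_product_def
  by (simp add: inner_derivation_add inner_derivation_diff inner_derivation_mult
      twist_inner_derivation add_simps twist_mult algebra_simps)

text \<open>
  The balanced form of \<open>[L\<^sub>a, {u v _}] = {(au) v _} - {u (av) _}\<close>. The Leibniz rule for
  \<open>[L\<^sub>u, L\<^sub>v]\<close> applied to \<open>aw\<close> matches all terms of the form \<open>(\<dots>)w\<close>; the commutators that remain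
  are those of the linearised Jordan identity. The powers of \<open>\<alpha>\<close> are those that make the terms
  balanced when \<open>a\<close> is a product of two elements.
\<close>

lemma mult_jordan_triple_product:
  "\<mu> (\<alpha> (\<alpha> a)) (\<alpha> (jordan_triple_product \<mu> \<alpha> u v w))
      - jordan_triple_product \<mu> \<alpha> (\<alpha> (\<alpha> u)) (\<alpha> (\<alpha> v)) (\<mu> a (\<alpha> w)) =
    jordan_triple_product \<mu> \<alpha> (\<mu> a (\<alpha> u)) (\<alpha> (\<alpha> v)) (\<alpha> (\<alpha> w))
      - jordan_triple_product \<mu> \<alpha> (\<alpha> (\<alpha> u)) (\<mu> a (\<alpha> v)) (\<alpha> (\<alpha> w))"
proof -
  have leibniz: "inner_derivation (\<alpha> (\<alpha> u)) (\<alpha> (\<alpha> v)) (\<mu> a (\<alpha> w)) =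
      \<mu> (inner_derivation (\<alpha> u) (\<alpha> v) a) (\<alpha> (\<alpha> (\<alpha> w)))
      + \<mu> (\<alpha> (\<alpha> a)) (\<alpha> (inner_derivation u v w))"
    by (simp add: inner_derivation_mult twist_inner_derivation)
  have jordan: "\<mu> (\<alpha> (\<alpha> a)) (\<mu> (\<alpha> (\<mu> u v)) (\<alpha> (\<alpha> w))) - \<mu> (\<alpha> (\<alpha> (\<mu> u v))) (\<mu> (\<alpha> a) (\<alpha> (\<alpha> w))) =
      inner_derivation (\<mu> a (\<alpha> u)) (\<alpha> (\<alpha> v)) (\<alpha> (\<alpha> w))
      - inner_derivation (\<alpha> (\<alpha> u)) (\<mu> a (\<alpha> v)) (\<alpha> (\<alpha> w))"
    using linearised_jordan_identity[of a "\<alpha> u" "\<alpha> v" "\<alpha> w"]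
    by (simp add: inner_derivation_def twist_mult mult_commute algebra_simps)
  have assoc: "inner_derivation (\<alpha> u) (\<alpha> v) a =
      \<mu> (\<alpha> (\<alpha> u)) (\<mu> a (\<alpha> v)) - \<mu> (\<mu> a (\<alpha> u)) (\<alpha> (\<alpha> v))"
    by (simp add: inner_derivation_def mult_commute)
  show ?thesis
    using jordan
    by (simp add: jordan_triple_product_eq leibniz assoc add_simps twist_mult algebra_simps)
qed

text \<open>
  With \<open>a = xy\<close> and \<open>D = [L\<^sub>x, L\<^sub>y]\<close>, the operators \<open>{x y _}\<close> and \<open>{y x _}\<close> are \<open>L\<^sub>a + D\<close> and
  \<open>L\<^sub>a - D\<close>. Because of this change of sign, the term \<open>{u {y x v} w}\<close> fits both the Leibniz rule,
  where \<open>{u (Dv) w}\<close> has a plus sign, and the rule for \<open>L\<^sub>a\<close>, where \<open>{u (av) w}\<close> has a minus sign.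
\<close>

lemma jordan_triple_product_identity:
  fixes x y u v w
  defines "T \<equiv> jordan_triple_product \<mu> \<alpha>"
  shows "T (\<alpha> (\<alpha> x)) (\<alpha> (\<alpha> y)) (T u v w) - T (\<alpha> (\<alpha> u)) (\<alpha> (\<alpha> v)) (T x y w) =
    T (T x y u) (\<alpha> (\<alpha> v)) (\<alpha> (\<alpha> w)) - T (\<alpha> (\<alpha> u)) (T y x v) (\<alpha> (\<alpha> w))"
proof -
  define a where "a = \<mu> x y"
  define D where "D = inner_derivation x y"
  have outer: "T (\<alpha> (\<alpha> x)) (\<alpha> (\<alpha> y)) p =
      \<mu> (\<alpha> (\<alpha> a)) (\<alpha> p) + inner_derivation (\<alpha> (\<alpha> x)) (\<alpha> (\<alpha> y)) p" for p
    by (simp add: T_def jordan_triple_product_eq a_def twist_mult)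
  have inner: "T x y p = \<mu> a (\<alpha> p) + D p" for p
    by (simp add: T_def jordan_triple_product_eq a_def D_def)
  have inner_swap: "T y x p = \<mu> a (\<alpha> p) - D p" for p
    using inner_derivation_swap[of y x p] mult_commute[of y x]
    by (simp add: T_def jordan_triple_product_eq a_def D_def)
  have additive:
    "T (p + p') q r = T p q r + T p' q r"
    "T p (q - q') r = T p q r - T p q' r"
    "T p q (r + r') = T p q r + T p q r'" for p p' q q' r r'
    by (simp_all add: T_def jordan_triple_product_add_left jordan_triple_product_diff_middle
        jordan_triple_product_add_right)
  show ?thesis
    using mult_jordan_triple_product[of a u v w, folded T_def]
      inner_derivation_jordan_triple_product[of x y u v w, folded T_def D_def]
    unfolding outer inner inner_swap additive
    by (simp add: algebra_simps)
qed

end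

theorem theorem3p1:
  fixes scale :: "'k::field_char_0 \<Rightarrow> 'a::ab_group_add \<Rightarrow> 'a"
    and \<mu> :: "'a \<Rightarrow> 'a \<Rightarrow> 'a"
    and \<alpha> :: "'a \<Rightarrow> 'a"
  assumes "multiplicative_hom_jordan_algebra scale \<mu> \<alpha>"
  shows "multiplicative_hom_jordan_triple_system scale (jordan_triple_product \<mu> \<alpha>) (\<alpha> ^^ 2)"
proof -
  interpret multiplicative_hom_jordan_algebra scale \<mu> \<alpha>
    by (rule assms)
  have square: "(\<alpha> ^^ 2) = (\<lambda>x. \<alpha> (\<alpha> x))"
    by (simp add: numeral_2_eq_2 fun_eq_iff)
  have linear_square: "Vector_Spaces.linear scale scale (\<lambda>x. \<alpha> (\<alpha> x))"
    using Vector_Spaces.linear_compose[OF linear_twist linear_twist] by (simp add: comp_def)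
  show ?thesis
    unfolding square
  proof unfold_locales
    show "trilinear_map scale (jordan_triple_product \<mu> \<alpha>)"
      by (rule trilinear_jordan_triple_product)
  qed (use linear_square in \<open>simp_all add: Vector_Spaces.linear_iff jordan_triple_product_commute
      jordan_triple_product_identity twist_jordan_triple_product\<close>)
qed

end
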